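(* Let $\{W_j\}_{j\in J}$ be an $f$-basis for $\mathcal{H}$. Then $\{W_j\}_{j\in J}$ is a Bessel $f$-basis for $\mathcal{H}$ if and only if there exists a constant $A>0$ such that $$A\sum_{j\in F}\|g_j\|^2\leq\Big\|\sum_{j\in F}g_j\Big\|^2$$ for any finite subset $F\subset J$ and arbitrary vectors $g_j\in W_j$.
   Context: $\mathcal{H}$ is a separable Hilbert space and $J$ is a countable (or finite) index set. A sequence $\{W_j\}_{j\in J}$ of closed subspaces of $\mathcal{H}$ is an $f$-basis (fusion Schauder basis) for $\mathcal{H}$ if for every $f\in\mathcal{H}$ there exists a unique sequence $\{g_j\}_{j\in J}$ with $g_j\in W_j$ such that $f=\sum_{j\in J}g_j$, with convergence in norm. Write $\big(\sum_{j\in J}\oplus W_j\big)_{\ell^2}=\{\{g_j\}_{j\in J} : g_j\in W_j,\ \sum_{j\in J}\|g_j\|^2<\infty\}$. An $f$-basis $\{W_j\}_{j\in J}$ is a Bessel $f$-basis if, for $g_j\in W_j$, whenever $\sum_{j\in J}g_j$ converges then $\{g_j\}_{j\in J}\in\big(\sum_{j\in J}\oplus W_j\big)_{\ell^2}$. *)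

theory Defs
  imports "HOL-Analysis.Analysis"
begin

text \<open>
  A Hilbert space is a type of class \<open>{real_inner, complete_space}\<close>. This covers complex Hilbert
  spaces as well: with the inner product Re<x,y> such a space is a real Hilbert space with
  the same norm, and its closed complex subspaces are closed real subspaces; the notions
  below involve no scalars other than through the word subspace.

  The countable index set \<open>J\<close> comes with an enumeration, given by a map \<open>e\<close> into the natural
  numbers that is injective on \<open>J\<close> (so \<open>J\<close> may be finite or infinite). As usual for Schauder bases,
  convergence of a series over \<open>J\<close> means norm convergence of the partial sums in the order
  of the enumeration, not unconditional convergence. Under the latter the Bessel property below would
  hold for every f-basis, since unconditionally convergent series in a Hilbert space have
  square-summable norms.
\<close>

definition series_sums :: "('i \<Rightarrow> nat) \<Rightarrow> 'i set \<Rightarrow> ('i \<Rightarrow> 'a::real_normed_vector) \<Rightarrow> 'a \<Rightarrow> bool" where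
  "series_sums e J g f \<longleftrightarrow> (\<lambda>n. \<Sum>j\<in>{j\<in>J. e j < n}. g j) \<longlonglongrightarrow> f"

text \<open>Families indexed by \<open>J\<close> are extensional functions on \<open>J\<close>, so that uniqueness is meaningful.\<close>

definition f_basis :: "('i \<Rightarrow> nat) \<Rightarrow> 'i set \<Rightarrow> ('i \<Rightarrow> 'a::real_normed_vector set) \<Rightarrow> bool" where
  "f_basis e J W \<longleftrightarrow>
     (\<forall>j\<in>J. subspace (W j) \<and> closed (W j)) \<and>
     (\<forall>f. \<exists>!g. g \<in> (\<Pi>\<^sub>E j\<in>J. W j) \<and> series_sums e J g f)"

definition l2_direct_sum :: "'i set \<Rightarrow> ('i \<Rightarrow> 'a::real_normed_vector set) \<Rightarrow> ('i \<Rightarrow> 'a) set" where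
  "l2_direct_sum J W = {g \<in> (\<Pi>\<^sub>E j\<in>J. W j). (\<lambda>j. (norm (g j))\<^sup>2) summable_on J}"

definition bessel_f_basis :: "('i \<Rightarrow> nat) \<Rightarrow> 'i set \<Rightarrow> ('i \<Rightarrow> 'a::real_normed_vector set) \<Rightarrow> bool" where
  "bessel_f_basis e J W \<longleftrightarrow>
     f_basis e J W \<and>
     (\<forall>g \<in> (\<Pi>\<^sub>E j\<in>J. W j). (\<exists>f. series_sums e J g f) \<longrightarrow> g \<in> l2_direct_sum J W)"

end

theory Submission
  imports Defs
begin

text \<open>
  If \<open>W\<close> is Bessel, then \<open>f \<mapsto> (\<Sum>\<^sub>j \<parallel>P\<^sub>j f\<parallel>\<^sup>2)\<^sup>1\<^sup>/\<^sup>2\<close> is a finite seminorm, where \<open>P\<^sub>j f\<close>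
  are the components of \<open>f\<close>, and the lower bound says exactly that it is bounded by a multiple of the norm.
  Boundedness comes from Zabreiko's lemma (a countably subadditive seminorm on a Banach space is
  bounded), used twice: first for \<open>f \<mapsto> sup\<^sub>n \<parallel>S\<^sub>n f\<parallel>\<close>, where \<open>S\<^sub>n\<close> are the partial sum
  operators, to see that every \<open>P\<^sub>j\<close> is continuous, and then for the seminorm above, which
  is a supremum of continuous seminorms.
  Conversely, the lower bound turns boundedness of the partial sums into square summability.
\<close>

section \<open>Absolutely convergent series in complete normed spaces\<close>

text \<open>
  The library version is stated for class \<open>banach\<close>, which a type of sort
  \<open>{real_normed_vector, complete_space}\<close> does not belong to.
\<close>

lemma summable_if_norm_summable:
  fixes f :: "nat \<Rightarrow> 'a::{real_normed_vector,complete_space}"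
  assumes "summable (\<lambda>n. norm (f n))"
  shows "summable f"
proof -
  have *: "norm (sum f {..<m} - sum f {..<n}) \<le> \<bar>(\<Sum>k<m. norm (f k)) - (\<Sum>k<n. norm (f k))\<bar>" for m n
  proof (induction m n rule: linorder_wlog)
    case (le m n)
    have "norm (sum f {..<m} - sum f {..<n}) = norm (sum f {m..<n})"
      by (simp add: lessThan_atLeast0 norm_minus_commute[of "sum f {0..<m}"] le
          flip: sum.atLeastLessThan_concat[of 0 m n f])

    also have "\<dots> \<le> (\<Sum>k\<in>{m..<n}. norm (f k))"
      by (rule norm_sum)
    finally show ?case
      using sum.atLeastLessThan_concat[of 0 m n "\<lambda>k. norm (f k)"] le
      by (simp add: lessThan_atLeast0)
  next
    case (sym m n)
    then show ?case
      by (simp add: norm_minus_commute abs_minus_commute)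
  qed
  have cauchy: "Cauchy (\<lambda>n. \<Sum>k<n. norm (f k))"
    using assms by (simp add: summable_iff_convergent convergent_Cauchy)
  have "Cauchy (\<lambda>n. sum f {..<n})"
  proof (rule metric_CauchyI)
    fix \<epsilon> :: real
    assume "\<epsilon> > 0"
    then obtain M where "\<forall>m\<ge>M. \<forall>n\<ge>M. norm ((\<Sum>k<m. norm (f k)) - (\<Sum>k<n. norm (f k))) < \<epsilon>"
      using CauchyD[OF cauchy] by blast
    then have "dist (sum f {..<m}) (sum f {..<n}) < \<epsilon>" if "m \<ge> M" "n \<ge> M" for m n
      using that *[of m n] order_le_less_trans unfolding dist_norm real_norm_def by blast
    then show "\<exists>M. \<forall>m\<ge>M. \<forall>n\<ge>M. dist (sum f {..<m}) (sum f {..<n}) < \<epsilon>"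
      by blast
  qed
  then show ?thesis
    by (simp add: summable_iff_convergent Cauchy_convergent)
qed

lemma norm_le_suminf_norm:
  fixes f :: "nat \<Rightarrow> 'a::real_normed_vector"
  assumes "f sums s" "summable (\<lambda>n. norm (f n))"
  shows "norm s \<le> (\<Sum>n. norm (f n))"
proof (rule LIMSEQ_le_const2)
  show "(\<lambda>n. norm (sum f {..<n})) \<longlonglongrightarrow> norm s"
    using assms(1) by (intro tendsto_norm) (simp add: sums_def)
  have "norm (sum f {..<n}) \<le> (\<Sum>n. norm (f n))" for n
    using norm_sum[of f "{..<n}"] sum_le_suminf[OF assms(2), of "{..<n}"] by simp
  then show "\<exists>N. \<forall>n\<ge>N. norm (sum f {..<n}) \<le> (\<Sum>n. norm (f n))"
    by blast
qed

section \<open>Zabreiko's lemma via Baire category\<close>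

lemma countably_subadditive_seminorm_bounded:
  fixes p :: "'a::{real_normed_vector,complete_space} \<Rightarrow> real"
  assumes nonneg: "\<And>x. 0 \<le> p x"
    and scale: "\<And>c x. p (c *\<^sub>R x) \<le> \<bar>c\<bar> * p x"
    and csub: "\<And>x s. x sums s \<Longrightarrow> summable (\<lambda>n. p (x n)) \<Longrightarrow> p s \<le> (\<Sum>n. p (x n))"
  obtains C where "C > 0" "\<And>x. p x \<le> C * norm x"
  \<comment> \<open>By Baire, some sublevel set of \<open>p\<close> is dense in a ball, so every \<open>x\<close> is a limit of approximations
      with geometrically decreasing \<open>p\<close>-cost, as in the open mapping theorem.\<close>
proof -
  have zero: "p 0 = 0"
    using scale[of 0 0] nonneg[of 0] by simp
  have add: "p (u + v) \<le> p u + p v" for u v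
  proof -
    \<comment> \<open>The series \<open>u, v, 0, 0, ...\<close> reduces finite to countable
      subadditivity, since \<open>p 0 = 0\<close>.\<close>
    define x where "x n = (if n = 0 then u else if n = 1 then v else 0)" for n :: nat
    have "x sums (\<Sum>n\<in>{0,1}. x n)"
      by (rule sums_finite) (auto simp: x_def)
    moreover have "(\<lambda>n. p (x n)) sums (\<Sum>n\<in>{0,1}. p (x n))"
      by (rule sums_finite) (auto simp: x_def zero)
    ultimately show ?thesis
      using csub[of x] by (force simp: x_def sums_iff)
  qed
  have diff: "p (u - v) \<le> p u + p v" for u v
    using add[of u "- v"] scale[of "-1" v] by simp
  \<comment> \<open>As \<open>p\<close> takes finite values, the closures of its sublevel sets cover
    the space, so they cannot all have empty interior.\<close>
  obtain N :: nat where N: "interior (closure {x. p x \<le> real N}) \<noteq> {}"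
  proof (rule ccontr)
    assume "\<not> thesis"
    with that have empty: "interior (closure {x. p x \<le> real n}) = {}" for n
      by blast
    let ?G = "range (\<lambda>n. closure {x. p x \<le> real n})"
    have "interior (\<Union>?G) = {}"
    proof -
      have "closedin euclidean T \<and> euclidean interior_of T = {}" if T: "T \<in> ?G" for T
      proof -
        obtain n where n: "T = closure {x. p x \<le> real n}"
          using T by blast
        show ?thesis
          unfolding n closed_closedin[symmetric] euclidean_interior_of empty by simp
      qed
      then have "euclidean interior_of \<Union>?G = {}"
        by (rule Met_TC.metric_Baire_category_alt[unfolded mtopology_is_euclidean mcomplete_iff_complete,
              OF complete_UNIV countable_image[OF countableI_type]])
      then show ?thesis
        unfolding euclidean_interior_of .
    qed
    moreover have "\<Union>?G = UNIV"
    proof -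
      have "x \<in> \<Union>?G" for x
      proof -
        obtain n where "p x \<le> real n"
          using real_arch_simple by blast
        then have "x \<in> closure {x. p x \<le> real n}"
          by (intro subsetD[OF closure_subset]) simp
        then show ?thesis by blast
      qed
      then show ?thesis by blast
    qed
    ultimately show False by simp
  qed
  then obtain a where "a \<in> interior (closure {x. p x \<le> real N})"
    by blast
  then obtain \<rho> where \<rho>: "\<rho> > 0" "ball a \<rho> \<subseteq> closure {x. p x \<le> real N}"
    unfolding mem_interior by blast
  \<comment> \<open>A difference of two points of the sublevel set costs at most
    \<open>2 * real N\<close>; rescaling it to approximate a vector of norm at most \<open>d\<close>
    multiplies this by \<open>d / \<rho>\<close>.\<close>
  define K where "K = 2 * real N / \<rho>"
  have K: "K \<ge> 0"
    using \<rho> by (simp add: K_def)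
  have approx: "\<exists>y. p y \<le> K * d \<and> norm (x - y) \<le> d / 2" if d: "d > 0" "norm x \<le> d" for x d
  proof -
    \<comment> \<open>This \<open>t\<close> keeps both \<open>a + t *\<^sub>R x\<close> and
      \<open>a - t *\<^sub>R x\<close> in the ball. Subtracting points \<open>u\<close> and
      \<open>v\<close> near them cancels the centre \<open>a\<close> and leaves about
      \<open>(2 * t) *\<^sub>R x\<close>. As \<open>1 / (2 * t) = d / \<rho>\<close>, two errors of
      \<open>\<rho> / 4\<close> become \<open>d / 2\<close>.\<close>
    define t where "t = \<rho> / (2 * d)"
    have t: "t > 0"
      using \<rho> d by (simp add: t_def)
    have "t * norm x \<le> t * d"
      using d t by (intro mult_left_mono) auto
    also have "t * d < \<rho>"
      using \<rho> d by (simp add: t_def)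
    finally have "a + t *\<^sub>R x \<in> ball a \<rho>" "a - t *\<^sub>R x \<in> ball a \<rho>"
      using t by (auto simp: dist_norm)
    then have cl: "a + t *\<^sub>R x \<in> closure {x. p x \<le> real N}" "a - t *\<^sub>R x \<in> closure {x. p x \<le> real N}"
      using \<rho> by auto
    obtain u where u: "p u \<le> real N" "norm (u - (a + t *\<^sub>R x)) < \<rho> / 4"
      using closure_approachableD[OF cl(1), of "\<rho> / 4"] \<rho>(1)
      by (auto simp: dist_norm norm_minus_commute)
    obtain v where v: "p v \<le> real N" "norm (v - (a - t *\<^sub>R x)) < \<rho> / 4"
      using closure_approachableD[OF cl(2), of "\<rho> / 4"] \<rho>(1)
      by (auto simp: dist_norm norm_minus_commute)
    define y where "y = (1 / (2 * t)) *\<^sub>R (u - v)"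
    have "p y \<le> (1 / (2 * t)) * p (u - v)"
      using t scale[of "1 / (2 * t)" "u - v"] by (simp add: y_def)
    also have "\<dots> \<le> (1 / (2 * t)) * (real N + real N)"
      using t u v diff[of u v] by (intro mult_left_mono) auto
    also have "\<dots> = K * d"
      using \<rho> d by (simp add: t_def K_def field_simps)
    finally have "p y \<le> K * d" .
    moreover have "norm (x - y) \<le> d / 2"
    proof -
      have "x - y = (1 / (2 * t)) *\<^sub>R ((v - (a - t *\<^sub>R x)) - (u - (a + t *\<^sub>R x)))"
        using t by (simp add: y_def algebra_simps flip: scaleR_left_distrib)
      then have "norm (x - y) = (1 / (2 * t)) * norm ((v - (a - t *\<^sub>R x)) - (u - (a + t *\<^sub>R x)))"
        using t by simp
      also have "\<dots> \<le> (1 / (2 * t)) * (\<rho> / 4 + \<rho> / 4)"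
        using t u v norm_triangle_ineq4[of "v - (a - t *\<^sub>R x)" "u - (a + t *\<^sub>R x)"]
        by (intro mult_left_mono) auto
      also have "\<dots> = d / 2"
        using \<rho> d by (simp add: t_def field_simps)
      finally show ?thesis .
    qed
    ultimately show ?thesis by blast
  qed
  define Y where "Y x d = (SOME y. p y \<le> K * d \<and> norm (x - y) \<le> d / 2)" for x d
  have Y: "p (Y x d) \<le> K * d \<and> norm (x - Y x d) \<le> d / 2" if "d > 0" "norm x \<le> d" for x d
    unfolding Y_def using approx[OF that] by (rule someI_ex)
  have bound: "p x \<le> 2 * K * norm x" for x
  proof (cases "x = 0")
    case False
    define d where "d = norm x"
    have d: "d > 0"
      using False by (simp add: d_def)
    \<comment> \<open>\<open>r n\<close> is the remainder after \<open>n\<close> approximations. Its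
      norm is at most \<open>d / 2 ^ n\<close>, so the corrections \<open>y n\<close> telescope to
      \<open>x\<close>, and their costs are dominated by a geometric series of total
      \<open>2 * K * d\<close>.\<close>
    define r where "r = rec_nat x (\<lambda>n r. r - Y r (d / 2 ^ n))"
    define y where "y n = Y (r n) (d / 2 ^ n)" for n
    have r_simps: "r 0 = x" "r (Suc n) = r n - y n" for n
      by (simp_all add: r_def y_def)
    have r_le: "norm (r n) \<le> d / 2 ^ n" for n
    proof (induction n)
      case (Suc n)
      then show ?case
        using Y[of "d / 2 ^ n" "r n"] d by (simp add: r_simps y_def)
    qed (simp add: r_simps d_def)
    have p_le: "p (y n) \<le> K * d * (1 / 2) ^ n" for n
      using Y[of "d / 2 ^ n" "r n"] d r_le by (simp add: y_def power_divide)
    have partial: "sum y {..<n} = x - r n" for n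
      by (induction n) (simp_all add: r_simps)
    have "(\<lambda>n. d * (1 / 2) ^ n) \<longlonglongrightarrow> d * 0"
      by (intro tendsto_mult tendsto_const LIMSEQ_power_zero) simp
    then have "r \<longlonglongrightarrow> 0"
      by (intro Lim_null_comparison[where f = r and g = "\<lambda>n. d * (1 / 2) ^ n"] always_eventually)
        (use r_le in \<open>simp_all add: power_divide\<close>)
    then have "y sums x"
      using tendsto_diff[of "\<lambda>_. x" x sequentially r 0] by (simp add: sums_def partial)
    have geo: "(\<lambda>n. K * d * (1 / 2) ^ n) sums (K * d * 2)"
      using geometric_sums[of "1 / 2 :: real"] by (intro sums_mult) simp
    have summ: "summable (\<lambda>n. p (y n))"
      by (rule summable_comparison_test'[OF sums_summable[OF geo], of 0]) (use p_le nonneg in auto)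
    have "p x \<le> (\<Sum>n. p (y n))"
      using \<open>y sums x\<close> summ by (rule csub)
    also have "\<dots> \<le> (\<Sum>n. K * d * (1 / 2) ^ n)"
      using p_le summ sums_summable[OF geo] by (rule suminf_le)
    also have "\<dots> = 2 * K * d"
      using geo by (simp add: sums_iff)
    finally show ?thesis
      by (simp add: d_def)
  qed (simp add: zero)
  show thesis
  proof
    \<comment> \<open>\<open>K\<close> vanishes if \<open>N = 0\<close>; adding 1 makes the constant
      strictly positive.\<close>
    show "2 * K + 1 > 0"
      using K by simp
    show "p x \<le> (2 * K + 1) * norm x" for x
      using bound[of x] by (simp add: distrib_right add_increasing2)
  qed
qed

section \<open>Coefficients of an f-basis expansion\<close>

text \<open>The component maps of the basis. The family is extensional, hence
  \<open>undefined\<close> outside \<open>J\<close>, so algebraic identities for it are stated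
  pointwise on \<open>J\<close>.\<close>

definition f_coeffs :: "('i \<Rightarrow> nat) \<Rightarrow> 'i set \<Rightarrow> ('i \<Rightarrow> 'a::real_normed_vector set) \<Rightarrow> 'a \<Rightarrow> 'i \<Rightarrow> 'a" where
  "f_coeffs e J W f = (THE g. g \<in> (\<Pi>\<^sub>E j\<in>J. W j) \<and> series_sums e J g f)"

lemma series_sums_cong:
  assumes "\<And>j. j \<in> J \<Longrightarrow> g j = h j"
  shows "series_sums e J g f \<longleftrightarrow> series_sums e J h f"
proof -
  have "(\<Sum>j\<in>{j \<in> J. e j < n}. g j) = (\<Sum>j\<in>{j \<in> J. e j < n}. h j)" for n
    using assms by (intro sum.cong) auto
  then show ?thesis
    by (simp add: series_sums_def)
qed

text \<open>Injectivity embeds the segment into \<open>{..<n}\<close>. Finiteness makes the partial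
  sums genuine, as \<open>sum\<close> over an infinite set is 0 by convention.\<close>

lemma finite_initial_segment:
  fixes e :: "'i \<Rightarrow> nat"
  assumes "inj_on e J"
  shows "finite {j \<in> J. e j < n}"
proof (rule finite_imageD)
  show "finite (e ` {j \<in> J. e j < n})"
    by (rule finite_subset[of _ "{..<n}"]) auto
  show "inj_on e {j \<in> J. e j < n}"
    using assms by (rule inj_on_subset) auto
qed

text \<open>The partial sums are constant once \<open>n\<close> exceeds every \<open>e j\<close>
  with \<open>j \<in> F\<close>.\<close>

lemma series_sums_finite_support:
  assumes inj: "inj_on e J" and F: "finite F" "F \<subseteq> J"
  shows "series_sums e J (\<lambda>j. if j \<in> F then g j else 0) (sum g F)"
proof -
  obtain N where N: "\<And>j. j \<in> F \<Longrightarrow> e j < N"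
    using F(1) finite_nat_set_iff_bounded[of "e ` F"] by auto
  have "(\<Sum>j\<in>{j \<in> J. e j < n}. if j \<in> F then g j else 0) = sum g F" if "n \<ge> N" for n
  proof -
    have "{j \<in> J. e j < n} \<inter> F = F"
      using F N that by fastforce
    then show ?thesis
      using finite_initial_segment[OF inj, of n] by (simp add: sum.If_cases)
  qed
  then have "\<forall>\<^sub>F n in sequentially. (\<Sum>j\<in>{j \<in> J. e j < n}. if j \<in> F then g j else 0) = sum g F"
    unfolding eventually_sequentially by blast
  then show ?thesis
    unfolding series_sums_def by (rule tendsto_eventually)
qed

context
  fixes J :: "'i set" and e :: "'i \<Rightarrow> nat" and W :: "'i \<Rightarrow> 'a::real_normed_vector set"
  assumes basis: "f_basis e J W"
begin

lemma W_subspace: "j \<in> J \<Longrightarrow> subspace (W j)"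
  and W_closed: "j \<in> J \<Longrightarrow> closed (W j)"
  using basis by (auto simp: f_basis_def)

lemma f_coeffs_props:
  shows f_coeffs_PiE: "f_coeffs e J W f \<in> (\<Pi>\<^sub>E j\<in>J. W j)"
    and f_coeffs_series_sums: "series_sums e J (f_coeffs e J W f) f"
proof -
  have "\<exists>!g. g \<in> (\<Pi>\<^sub>E j\<in>J. W j) \<and> series_sums e J g f"
    using basis by (auto simp: f_basis_def)
  from theI'[OF this] show "f_coeffs e J W f \<in> (\<Pi>\<^sub>E j\<in>J. W j)"
    and "series_sums e J (f_coeffs e J W f) f"
    by (auto simp: f_coeffs_def)
qed

lemma f_coeffs_in: "j \<in> J \<Longrightarrow> f_coeffs e J W f j \<in> W j"
  using f_coeffs_PiE by (rule PiE_mem)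

text \<open>Uniqueness of the expansion, in the form used to identify coefficients. Values of
  \<open>g\<close> outside \<open>J\<close> are arbitrary, since restricting \<open>g\<close> to
  \<open>J\<close> leaves the series unchanged.\<close>

lemma f_coeffs_eqI:
  assumes "\<And>j. j \<in> J \<Longrightarrow> g j \<in> W j" "series_sums e J g f" "j \<in> J"
  shows "f_coeffs e J W f j = g j"
proof -
  have ex1: "\<exists>!g. g \<in> (\<Pi>\<^sub>E j\<in>J. W j) \<and> series_sums e J g f"
    using basis by (auto simp: f_basis_def)
  have "series_sums e J (restrict g J) f"
    using assms(2) series_sums_cong[of J "restrict g J" g] by simp
  then have "f_coeffs e J W f = restrict g J"
    unfolding f_coeffs_def using assms(1) by (intro the1_equality[OF ex1]) auto
  then show ?thesis
    using assms(3) by simp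
qed

lemma f_coeffs_add:
  assumes "j \<in> J"
  shows "f_coeffs e J W (f + f') j = f_coeffs e J W f j + f_coeffs e J W f' j"
proof (rule f_coeffs_eqI[OF _ _ assms])
  show "series_sums e J (\<lambda>j. f_coeffs e J W f j + f_coeffs e J W f' j) (f + f')"
    using f_coeffs_series_sums[of f] f_coeffs_series_sums[of f']
    by (auto simp: series_sums_def sum.distrib intro: tendsto_add)
qed (auto intro: subspace_add W_subspace f_coeffs_in)

lemma f_coeffs_scaleR:
  assumes "j \<in> J"
  shows "f_coeffs e J W (c *\<^sub>R f) j = c *\<^sub>R f_coeffs e J W f j"
proof (rule f_coeffs_eqI[OF _ _ assms])
  show "series_sums e J (\<lambda>j. c *\<^sub>R f_coeffs e J W f j) (c *\<^sub>R f)"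
    using f_coeffs_series_sums[of f]
    by (auto simp: series_sums_def simp flip: scaleR_right.sum intro: tendsto_scaleR)
qed (auto intro: subspace_scale W_subspace f_coeffs_in)

text \<open>Extending \<open>g\<close> by zero stays in the subspaces and expands the finite sum, so
  uniqueness applies. This turns bounds on coefficients into bounds on arbitrary finite
  families.\<close>

lemma f_coeffs_finite_sum:
  assumes inj: "inj_on e J" and F: "finite F" "F \<subseteq> J" and g: "\<And>j. j \<in> F \<Longrightarrow> g j \<in> W j" and j: "j \<in> F"
  shows "f_coeffs e J W (sum g F) j = g j"
proof -
  have "f_coeffs e J W (sum g F) j = (if j \<in> F then g j else 0)"
    using F j g by (intro f_coeffs_eqI series_sums_finite_support[OF inj])
      (auto intro: subspace_0 W_subspace)
  then show ?thesis
    using j by simp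
qed

end

section \<open>Continuity of the coefficients and the Bessel bound\<close>

context
  fixes J :: "'i set" and e :: "'i \<Rightarrow> nat"
    and W :: "'i \<Rightarrow> 'a::{real_normed_vector,complete_space} set"
  assumes inj: "inj_on e J" and basis: "f_basis e J W"
begin

text \<open>
  Countable subadditivity of \<open>f \<mapsto> sup\<^sub>n \<parallel>S\<^sub>n f\<parallel>\<close>: the expansions of the terms of a series can be
  added up, and by uniqueness this gives the expansion of its sum.
\<close>

lemma bounded_linear_f_coeffs:
  assumes j: "j \<in> J"
  shows "bounded_linear (\<lambda>f. f_coeffs e J W f j)"
proof -
  define S where "S n f = (\<Sum>j\<in>{j \<in> J. e j < n}. f_coeffs e J W f j)" for n f
  define p where "p f = (SUP n. norm (S n f))" for f
  note fin = finite_initial_segment[OF inj]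
  have S_lim: "(\<lambda>n. S n f) \<longlonglongrightarrow> f" for f
    using f_coeffs_series_sums[OF basis, of f] by (simp add: series_sums_def S_def)
  have bdd: "bdd_above (range (\<lambda>n. norm (S n f)))" for f
    using convergent_imp_Bseq[OF convergentI[OF S_lim[of f]]] by (auto simp: Bseq_def bdd_above_def)
  have S_le: "norm (S n f) \<le> p f" for n f
    unfolding p_def by (rule cSUP_upper[OF _ bdd]) simp
  have p_le: "p f \<le> c" if "\<And>n. norm (S n f) \<le> c" for f c
    unfolding p_def using that by (intro cSUP_least) auto
  have p_nonneg: "0 \<le> p f" for f
    using order_trans[OF norm_ge_zero S_le[of 0]] .
  have norm_le: "norm f \<le> p f" for f
    by (rule LIMSEQ_le_const2[OF tendsto_norm[OF S_lim]]) (use S_le in blast)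
  have S_scale: "S n (c *\<^sub>R f) = c *\<^sub>R S n f" for n c f
    unfolding S_def scaleR_right.sum
    by (intro sum.cong) (auto simp: f_coeffs_scaleR[OF basis])
  have p_scale: "p (c *\<^sub>R f) \<le> \<bar>c\<bar> * p f" for c f
    by (rule p_le) (simp add: S_scale S_le mult_left_mono)
  have coeff_le: "norm (f_coeffs e J W f i) \<le> 2 * p f" if i: "i \<in> J" for f i
  proof -
    \<comment> \<open>By injectivity only \<open>i\<close> enters between these two segments, so a
      coefficient is a difference of consecutive partial sums.\<close>
    have "{j \<in> J. e j < Suc (e i)} = insert i {j \<in> J. e j < e i}"
      using i inj by (auto simp: less_Suc_eq dest: inj_onD)
    then have "S (Suc (e i)) f = f_coeffs e J W f i + S (e i) f"
      using fin[of "e i"] by (simp add: S_def)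
    then have "norm (f_coeffs e J W f i) = norm (S (Suc (e i)) f - S (e i) f)"
      by simp
    also have "\<dots> \<le> 2 * p f"
      using norm_triangle_ineq4[of "S (Suc (e i)) f" "S (e i) f"] S_le[of "Suc (e i)" f] S_le[of "e i" f]
      by linarith
    finally show ?thesis .
  qed
  have csub: "p s \<le> (\<Sum>k. p (x k))" if x: "x sums s" and summ: "summable (\<lambda>k. p (x k))" for x s
  proof -
    \<comment> \<open>The candidate coefficients of \<open>s\<close>. The series converge absolutely
      by \<open>coeff_le\<close>, and closedness of \<open>W i\<close> keeps their sums in
      \<open>W i\<close>.\<close>
    define g where "g i = (\<Sum>k. f_coeffs e J W (x k) i)" for i
    have summ2: "summable (\<lambda>k. 2 * p (x k))"
      using summ by (rule summable_mult)
    have g_sums: "(\<lambda>k. f_coeffs e J W (x k) i) sums g i" if i: "i \<in> J" for i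
      unfolding g_def
      by (intro summable_sums, rule summable_if_norm_summable,
          rule summable_comparison_test'[OF summ2, of 0]) (simp add: coeff_le i)
    have g_in: "g i \<in> W i" if i: "i \<in> J" for i
    proof -
      have "(\<Sum>k<n. f_coeffs e J W (x k) i) \<in> W i" for n
        using i by (intro subspace_sum W_subspace[OF basis] f_coeffs_in[OF basis])
      then show ?thesis
        by (rule closed_sequentially[OF W_closed[OF basis i] _ g_sums[OF i, unfolded sums_def]])
    qed
    define T where "T n = (\<Sum>i\<in>{j \<in> J. e j < n}. g i)" for n
    have T_sums: "(\<lambda>k. S n (x k)) sums T n" for n
      unfolding S_def T_def by (intro sums_sum g_sums) auto
    have S_summ: "summable (\<lambda>k. norm (S n (x k)))" for n
      by (rule summable_comparison_test'[OF summ, of 0]) (simp add: S_le)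
    have T_le: "norm (T n) \<le> (\<Sum>k. p (x k))" for n
      using norm_le_suminf_norm[OF T_sums S_summ, of n] suminf_le[OF S_le S_summ summ, of n]
      by linarith
    \<comment> \<open>To see that \<open>T n\<close> tends to \<open>s\<close>, write
      \<open>T n - s\<close> as the sum over \<open>k\<close> of \<open>S n (x k) - x k\<close>.
      Each term tends to 0, and the summable bound \<open>2 * p (x k)\<close> is independent of
      \<open>n\<close>, so Tannery's theorem exchanges limit and sum.\<close>
    define h where "h k n = norm (S n (x k) - x k)" for k n
    have h_lim: "(\<lambda>n. h k n) \<longlonglongrightarrow> 0" for k
      unfolding h_def using tendsto_norm_zero[OF LIM_zero[OF S_lim[of "x k"]]] .
    have h_le: "norm (h k n) \<le> 2 * p (x k)" for k n
      unfolding h_def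
      using norm_triangle_ineq4[of "S n (x k)" "x k"] S_le[of n "x k"] norm_le[of "x k"] by simp
    have h_summ: "summable (\<lambda>k. norm (S n (x k) - x k))" for n
      using summable_comparison_test'[OF summ2, of 0 "\<lambda>k. h k n"] h_le by (simp add: h_def)
    have "norm (T n - s) \<le> (\<Sum>k. h k n)" for n
      unfolding h_def by (intro norm_le_suminf_norm sums_diff T_sums x h_summ)
    moreover have "(\<lambda>n. \<Sum>k. h k n) \<longlonglongrightarrow> (\<Sum>k. 0)"
    proof -
      have "\<forall>\<^sub>F (k, n) in sequentially \<times>\<^sub>F sequentially. norm (h k n) \<le> 2 * p (x k)"
        by (intro always_eventually) (use h_le in auto)
      from tannerys_theorem[OF h_lim this summ2] show ?thesis
        by simp
    qed
    ultimately have "(\<lambda>n. T n - s) \<longlonglongrightarrow> 0"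
      using Lim_null_comparison[of "\<lambda>n. T n - s" "\<lambda>n. \<Sum>k. h k n" sequentially] by simp
    then have "T \<longlonglongrightarrow> s"
      by (rule LIM_zero_cancel)
    then have "f_coeffs e J W s i = g i" if "i \<in> J" for i
      using that g_in by (intro f_coeffs_eqI[OF basis]) (auto simp: series_sums_def T_def[abs_def])
    then have "S n s = T n" for n
      unfolding S_def T_def by (intro sum.cong) auto
    then show ?thesis
      using T_le by (intro p_le) simp
  qed
  obtain C where C: "\<And>f. p f \<le> C * norm f"
    using countably_subadditive_seminorm_bounded[OF p_nonneg p_scale csub] by blast
  show ?thesis
  proof (rule bounded_linear_intro)
    show "norm (f_coeffs e J W f j) \<le> norm f * (2 * C)" for f
      using coeff_le[OF j, of f] C[of f] by (simp add: algebra_simps)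
  qed (simp_all add: f_coeffs_add[OF basis j] f_coeffs_scaleR[OF basis j])
qed

text \<open>The Bessel property makes the supremum \<open>q f\<close> of the finite sections
  \<open>L f F\<close> finite for every \<open>f\<close>. Continuity of each section makes
  \<open>q\<close> countably subadditive, hence bounded by a multiple of the norm.\<close>

lemma bessel_f_basis_coeffs_bounded:
  assumes bessel: "bessel_f_basis e J W"
  obtains C where "C > 0"
    "\<And>f F. finite F \<Longrightarrow> F \<subseteq> J \<Longrightarrow> L2_set (\<lambda>j. norm (f_coeffs e J W f j)) F \<le> C * norm f"
proof -
  define L where "L f = L2_set (\<lambda>j. norm (f_coeffs e J W f j))" for f
  define \<F> where "\<F> = {F. finite F \<and> F \<subseteq> J}"
  define q where "q f = (SUP F\<in>\<F>. L f F)" for f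
  have ne: "\<F> \<noteq> {}"
    by (auto simp: \<F>_def)
  have bdd: "bdd_above (L f ` \<F>)" for f
  proof -
    have "f_coeffs e J W f \<in> l2_direct_sum J W"
      using bessel f_coeffs_props[OF basis, of f] by (auto simp: bessel_f_basis_def)
    then have summ: "(\<lambda>j. (norm (f_coeffs e J W f j))\<^sup>2) summable_on J"
      by (simp add: l2_direct_sum_def)
    show ?thesis
    proof (rule bdd_aboveI2)
      fix F assume "F \<in> \<F>"
      then have "(\<Sum>j\<in>F. (norm (f_coeffs e J W f j))\<^sup>2) \<le> (\<Sum>\<^sub>\<infinity>j\<in>J. (norm (f_coeffs e J W f j))\<^sup>2)"
        by (intro finite_sum_le_infsum summ) (auto simp: \<F>_def)
      then show "L f F \<le> sqrt (\<Sum>\<^sub>\<infinity>j\<in>J. (norm (f_coeffs e J W f j))\<^sup>2)"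
        by (simp add: L_def L2_set_def)
    qed
  qed
  have L_le: "L f F \<le> q f" if "F \<in> \<F>" for f F
    unfolding q_def using that bdd by (rule cSUP_upper)
  have q_le: "q f \<le> c" if "\<And>F. F \<in> \<F> \<Longrightarrow> L f F \<le> c" for f c
    unfolding q_def using ne that by (rule cSUP_least)
  have L_nonneg: "0 \<le> L f F" for f F
    by (simp add: L_def)
  have q_nonneg: "0 \<le> q f" for f
    using L_le[of "{}" f] L_nonneg[of f "{}"] by (simp add: \<F>_def)
  have L_scale: "L (c *\<^sub>R f) F = \<bar>c\<bar> * L f F" if "F \<in> \<F>" for c f F
  proof -
    have "L (c *\<^sub>R f) F = L2_set (\<lambda>j. \<bar>c\<bar> * norm (f_coeffs e J W f j)) F"
      unfolding L_def using that by (intro L2_set_cong) (auto simp: \<F>_def f_coeffs_scaleR[OF basis])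
    then show ?thesis
      by (simp add: L_def L2_set_right_distrib)
  qed
  have q_scale: "q (c *\<^sub>R f) \<le> \<bar>c\<bar> * q f" for c f
    by (rule q_le) (simp add: L_scale L_le mult_left_mono)
  have csub: "q s \<le> (\<Sum>k. q (x k))" if x: "x sums s" and summ: "summable (\<lambda>k. q (x k))" for x s
  proof (rule q_le)
    fix F assume F: "F \<in> \<F>"
    have L_add: "L (u + v) F \<le> L u F + L v F" for u v
    proof -
      have "L (u + v) F \<le> L2_set (\<lambda>j. norm (f_coeffs e J W u j) + norm (f_coeffs e J W v j)) F"
        unfolding L_def using F
        by (intro L2_set_mono) (auto simp: \<F>_def f_coeffs_add[OF basis] norm_triangle_ineq)
      also have "\<dots> \<le> L u F + L v F"
        unfolding L_def by (rule L2_set_triangle_ineq)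
      finally show ?thesis .
    qed
    have L_0: "L 0 F = 0"
      using L_scale[OF F, of 0 0] by simp
    have L_sum: "L (\<Sum>k<n. x k) F \<le> (\<Sum>k. q (x k))" for n
    proof -
      have "L (\<Sum>k<n. x k) F \<le> (\<Sum>k<n. L (x k) F)"
      proof (induction n)
        case (Suc n)
        then show ?case
          using L_add[of "\<Sum>k<n. x k" "x n"] by simp
      qed (simp add: L_0)
      also have "\<dots> \<le> (\<Sum>k<n. q (x k))"
        by (rule sum_mono) (rule L_le[OF F])
      also have "\<dots> \<le> (\<Sum>k. q (x k))"
        using q_nonneg by (intro sum_le_suminf summ) auto
      finally show ?thesis .
    qed
    \<comment> \<open>Continuity of the coefficients enters here: for a fixed finite
      \<open>F\<close>, the estimate passes from the partial sums to \<open>s\<close>. The supremum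
      over \<open>F\<close> is taken only afterwards.\<close>
    have "(\<lambda>n. L (\<Sum>k<n. x k) F) \<longlonglongrightarrow> L s F"
      unfolding L_def L2_set_def using F x
      by (intro tendsto_real_sqrt tendsto_sum tendsto_power tendsto_norm
          bounded_linear.tendsto[OF bounded_linear_f_coeffs]) (auto simp: \<F>_def sums_def)
    then show "L s F \<le> (\<Sum>k. q (x k))"
      by (rule LIMSEQ_le_const2) (use L_sum in blast)
  qed
  obtain C where "C > 0" and C: "\<And>f. q f \<le> C * norm f"
    using countably_subadditive_seminorm_bounded[OF q_nonneg q_scale csub] by blast
  show thesis
  proof
    show "L2_set (\<lambda>j. norm (f_coeffs e J W f j)) F \<le> C * norm f" if "finite F" "F \<subseteq> J" for f F
      using L_le[of F f] C[of f] that by (simp add: L_def \<F>_def)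
  qed fact
qed

end

section \<open>The Bessel property and the lower bound\<close>

theorem theorem2p12:
  fixes J :: "'i set" and e :: "'i \<Rightarrow> nat"
    and W :: "'i \<Rightarrow> 'a::{real_inner, complete_space} set"
  assumes separable: "\<exists>D::'a set. countable D \<and> closure D = UNIV"
    and enumeration: "inj_on e J"
    and basis: "f_basis e J W"
  shows "bessel_f_basis e J W \<longleftrightarrow>
    (\<exists>A::real. A > 0 \<and>
      (\<forall>F g. finite F \<and> F \<subseteq> J \<and> (\<forall>j\<in>F. g j \<in> W j) \<longrightarrow>
        A * (\<Sum>j\<in>F. (norm (g j))\<^sup>2) \<le> (norm (\<Sum>j\<in>F. g j))\<^sup>2))"
    (is "_ \<longleftrightarrow> (\<exists>A. A > 0 \<and> ?lower A)")
proof
  assume "bessel_f_basis e J W"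
  then obtain C where C: "C > 0" and le:
    "\<And>f F. finite F \<Longrightarrow> F \<subseteq> J \<Longrightarrow> L2_set (\<lambda>j. norm (f_coeffs e J W f j)) F \<le> C * norm f"
    using bessel_f_basis_coeffs_bounded[OF enumeration basis] by blast
  \<comment> \<open>The coefficient bound is applied to \<open>sum g F\<close>, whose coefficients
    on \<open>F\<close> are the \<open>g j\<close>; squaring it gives the constant
    \<open>1 / C\<^sup>2\<close>.\<close>
  have "?lower (1 / C\<^sup>2)"
  proof (intro allI impI; elim conjE)
    fix F g assume F: "finite F" "F \<subseteq> J" and g: "\<forall>j\<in>F. g j \<in> W j"
    have "L2_set (\<lambda>j. norm (f_coeffs e J W (sum g F) j)) F = L2_set (\<lambda>j. norm (g j)) F"
      using F g by (intro L2_set_cong) (simp_all add: f_coeffs_finite_sum[OF basis enumeration])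
    then have "L2_set (\<lambda>j. norm (g j)) F \<le> C * norm (sum g F)"
      using le[OF F, of "sum g F"] by simp
    then have "(L2_set (\<lambda>j. norm (g j)) F)\<^sup>2 \<le> (C * norm (sum g F))\<^sup>2"
      by (intro power_mono) simp_all
    then show "1 / C\<^sup>2 * (\<Sum>j\<in>F. (norm (g j))\<^sup>2) \<le> (norm (sum g F))\<^sup>2"
      using C by (simp add: L2_set_def sum_nonneg power_mult_distrib field_simps)
  qed
  then show "\<exists>A. A > 0 \<and> ?lower A"
    using C by (intro exI[of _ "1 / C\<^sup>2"]) simp
next
  assume "\<exists>A. A > 0 \<and> ?lower A"
  then obtain A where A: "A > 0" and lower: "?lower A" by blast
  have "g \<in> l2_direct_sum J W" if g: "g \<in> (\<Pi>\<^sub>E j\<in>J. W j)" and f: "series_sums e J g f" for g f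
  proof -
    have "Bseq (\<lambda>n. \<Sum>j\<in>{j \<in> J. e j < n}. g j)"
      using convergent_imp_Bseq[OF convergentI[OF f[unfolded series_sums_def]]] .
    then obtain M where M: "\<And>n. norm (\<Sum>j\<in>{j \<in> J. e j < n}. g j) \<le> M"
      by (auto simp: Bseq_def)
    \<comment> \<open>The lower bound is applied to an initial segment containing \<open>F\<close>,
      because the vector sums known to be bounded by \<open>M\<close> are those over initial
      segments. The resulting bound does not depend on \<open>F\<close>, which yields
      summability.\<close>
    have "(\<Sum>j\<in>F. (norm (g j))\<^sup>2) \<le> M\<^sup>2 / A" if F: "finite F" "F \<subseteq> J" for F
    proof -
      obtain n where n: "\<And>j. j \<in> F \<Longrightarrow> e j < n"
        using F(1) finite_nat_set_iff_bounded[of "e ` F"] by auto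
      let ?I = "{j \<in> J. e j < n}"
      have fin: "finite ?I"
        by (rule finite_initial_segment[OF enumeration])
      have "(\<Sum>j\<in>F. (norm (g j))\<^sup>2) \<le> (\<Sum>j\<in>?I. (norm (g j))\<^sup>2)"
        using fin F n by (intro sum_mono2) auto
      then have "A * (\<Sum>j\<in>F. (norm (g j))\<^sup>2) \<le> A * (\<Sum>j\<in>?I. (norm (g j))\<^sup>2)"
        using A by simp
      moreover have "A * (\<Sum>j\<in>?I. (norm (g j))\<^sup>2) \<le> (norm (\<Sum>j\<in>?I. g j))\<^sup>2"
        using lower fin g by (auto dest: PiE_mem)
      moreover have "(norm (\<Sum>j\<in>?I. g j))\<^sup>2 \<le> M\<^sup>2"
        using M by (intro power_mono) auto
      ultimately have "A * (\<Sum>j\<in>F. (norm (g j))\<^sup>2) \<le> M\<^sup>2"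
        by linarith
      then show ?thesis
        using A by (simp add: field_simps)
    qed
    then have "(\<lambda>j. (norm (g j))\<^sup>2) summable_on J"
      by (intro nonneg_bdd_above_summable_on bdd_aboveI2[where M = "M\<^sup>2 / A"]) auto
    then show ?thesis
      using g by (simp add: l2_direct_sum_def)
  qed
  then show "bessel_f_basis e J W"
    using basis by (auto simp: bessel_f_basis_def)
qed

end
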